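(* Let $(D,\delta)$ be a finite empirical design in $K^d$, with $n=|D|$. Then the procedure AllStableOrderIdeals() (defined in the context), run on $(D,\delta)$, computes the numerical statistical fan of $(D,\delta)$: the set $S$ it returns is $S_{num}(D,\delta)$, the set of all maximal stable order ideals for $(D,\delta)$.
   Context: Let $K=\mathbb{Q}$ or $\mathbb{R}$, $d\ge 1$, $R=K[X_1,\dots,X_d]$, and let $\mathcal{T}=\{X_1^{\alpha_1}\cdots X_d^{\alpha_d}\mid \alpha_i\in\mathbb{Z}_{\ge 0}\}$ be the set of terms (monomials). A design is a finite set $D=\{p_1,\dots,p_n\}$ of $n$ distinct points in $K^d\subseteq\mathbb{R}^d$. An order ideal is a finite subset $\mathcal{O}\subset\mathcal{T}$ closed under divisibility: $t\in\mathcal{O}$ and $t'\mid t$ imply $t'\in\mathcal{O}$ (the empty set is allowed). The corner set of $\mathcal{O}$ is the set of minimal elements, with respect to divisibility, of $\mathcal{T}\setminus\mathcal{O}$; equivalently, the set of $t\in\mathcal{T}\setminus\mathcal{O}$ such that $\mathcal{O}\cup\{t\}$ is an order ideal. It is a finite set. For a term $t$ the design vector is $t(D)=(t(p_1),\dots,t(p_n))^t$, and the design matrix $X_{\mathcal{O}}(D)$ is the $n\times|\mathcal{O}|$ matrix whose columns are the vectors $t(D)$, $t\in\mathcal{O}$ (in some order). An empirical design is a pair $(D,\delta)$ with $D$ a design and $\delta=(\delta_1,\dots,\delta_d)$, $\delta_i\ge 0$. A point $\tilde p=(\tilde c_1,\dots,\tilde c_d)\in\mathbb{R}^d$ is a $\delta$-perturbation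 of $p=(c_1,\dots,c_d)$ if $|\tilde c_i-c_i|\le\delta_i$ for all $i$. A design $\tilde D=\{\tilde p_1,\dots,\tilde p_n\}\subset\mathbb{R}^d$ is a $\delta$-perturbation of $D$ if there is a one-to-one correspondence $p_i\leftrightarrow\tilde p_i$ between $D$ and $\tilde D$ such that each $\tilde p_i$ is a $\delta$-perturbation of $p_i$. Given a finite set of terms $\mathcal{O}$ and a term $t$, $t(D)$ numerically depends on $\mathcal{O}(D)=\{s(D): s\in\mathcal{O}\}$ (equivalently, on the columns of $X_{\mathcal{O}}(D)$) if there is a $\delta$-perturbation $\tilde D$ of $D$ such that $t(\tilde D)$ lies in the linear span of $\{s(\tilde D): s\in\mathcal{O}\}$; otherwise $t(D)$ is numerically (linearly) independent of $\mathcal{O}(D)$. An order ideal $\mathcal{O}$ is stable for $(D,\delta)$ if $X_{\mathcal{O}}(\tilde D)$ has full column rank for every $\delta$-perturbation $\tilde D$ of $D$. A stable order ideal is maximal if it is not properly contained in another stable order ideal. The numerical statistical fan $S_{num}(D,\delta)$ is the set of all maximal stable order ideals for $(D,\delta)$. Procedures (numerical independence is tested exactly: $t(D)$ is declared numerically linearly independent of $\mathcal{O}(D)$ if and only if there is no $\delta$-perturbation $\tilde D$ of $D$ such that $t(\tilde D)$ lies in the linear span of $\{s(\tilde D): s\in\mathcal{O}\}$). AllStableOrderIdeals(): initialize $S:=\{\}$, $HS:=\{\}$, $\mathcal{O}:=\{\}$ (empty sets), $C:=\{1\}$, and $M$ as the $n\times 0$ matrix; set $(S,\mathcal{O},C,M,HS):=$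 AllStableOIStep$(S,\mathcal{O},C,M,HS)$; return $S$. AllStableOIStep$(S,\mathcal{O},C,M,HS)$ (here $\mathcal{O}$ is the current order ideal, $C$ its corner set, $M=X_{\mathcal{O}}(D)$; the variables $\mathcal{O}_{in},C_{in},M_{in},Maxbool$ are local to each call): 1. $\mathcal{O}_{in}:=\mathcal{O}$; $C_{in}:=C$; $M_{in}:=M$. 2. If $\mathcal{O}\notin S$, then: (a) $Maxbool:=TRUE$. (b) For each $t\in C_{in}$: reset $\mathcal{O}:=\mathcal{O}_{in}$, $C:=C_{in}$, $M:=M_{in}$; if $t(D)$ is numerically linearly independent of the columns of $M$ (i.e. of $\mathcal{O}(D)$), then set $Maxbool:=FALSE$, and, if moreover $\mathcal{O}\cup\{t\}\notin HS$, then add $t(D)$ as last column to $M$, set $\mathcal{O}:=\mathcal{O}\cup\{t\}$, set $C$ to be the corner set of this new $\mathcal{O}$, include the new $\mathcal{O}$ in $HS$, and set $(S,\mathcal{O},C,M,HS):=$ AllStableOIStep$(S,\mathcal{O},C,M,HS)$. (c) If $Maxbool=TRUE$, include $\mathcal{O}$ in $S$. 3. Return $(S,\mathcal{O},C,M,HS)$. *)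

theory Defs
  imports "Jordan_Normal_Form.DL_Rank" "HOL-Library.Monad_Syntax"
begin

text \<open>
  The indeterminates are indexed by a finite type \<open>'d\<close>, so that the dimension is \<open>CARD('d) \<ge> 1\<close>.
  Real vectors and matrices of run-time size are those of \<open>Jordan_Normal_Form\<close>.
\<close>

type_synonym 'd point = "'d \<Rightarrow> real"

text \<open>A term is represented by its exponent vector; multiplication adds exponents.\<close>

type_synonym 'd power_product = "'d \<Rightarrow> nat"

definition pp_one :: "'d power_product" where
  "pp_one = (\<lambda>i. 0)"

definition pp_mult :: "'d power_product \<Rightarrow> 'd power_product \<Rightarrow> 'd power_product" where
  "pp_mult s t = (\<lambda>i. s i + t i)"

definition pp_dvd :: "'d power_product \<Rightarrow> 'd power_product \<Rightarrow> bool" where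
  "pp_dvd s t \<longleftrightarrow> (\<exists>u. t = pp_mult s u)"

definition pp_eval :: "'d::finite power_product \<Rightarrow> 'd point \<Rightarrow> real" where
  "pp_eval t p = (\<Prod>i\<in>UNIV. p i ^ t i)"

definition order_ideal :: "'d power_product set \<Rightarrow> bool" where
  "order_ideal Q \<longleftrightarrow> finite Q \<and> (\<forall>t\<in>Q. \<forall>s. pp_dvd s t \<longrightarrow> s \<in> Q)"

definition corner_set :: "'d power_product set \<Rightarrow> 'd power_product set" where
  "corner_set Q = {t. t \<notin> Q \<and> (\<forall>s. s \<notin> Q \<longrightarrow> pp_dvd s t \<longrightarrow> s = t)}"

text \<open>
  An arbitrary but fixed listing of a finite set. It numbers the points of a design
  (rows of the design matrix) and the elements of a set of terms (columns).
\<close>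

definition enumeration :: "'a set \<Rightarrow> 'a list" where
  "enumeration A = (SOME xs. distinct xs \<and> set xs = A)"

definition design_vector :: "'d::finite power_product \<Rightarrow> 'd point set \<Rightarrow> real vec" where
  "design_vector t D = vec (card D) (\<lambda>k. pp_eval t (enumeration D ! k))"

definition design_matrix :: "'d::finite power_product set \<Rightarrow> 'd point set \<Rightarrow> real mat" where
  "design_matrix Q D = mat_of_cols (card D) (map (\<lambda>t. design_vector t D) (enumeration Q))"

text \<open>Only the points of the design, not their perturbations, are required to lie in \<open>K\<^sup>d\<close>.\<close>

definition empirical_design :: "real set \<Rightarrow> 'd point set \<Rightarrow> ('d \<Rightarrow> real) \<Rightarrow> bool" where
  "empirical_design K D \<delta> \<longleftrightarrow>
     finite D \<and> (\<forall>p\<in>D. \<forall>i. p i \<in> K) \<and> (\<forall>i. \<delta> i \<ge> 0)"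

definition point_perturbation :: "('d \<Rightarrow> real) \<Rightarrow> 'd point \<Rightarrow> 'd point \<Rightarrow> bool" where
  "point_perturbation \<delta> p p' \<longleftrightarrow> (\<forall>i. \<bar>p' i - p i\<bar> \<le> \<delta> i)"

definition perturbation :: "('d \<Rightarrow> real) \<Rightarrow> 'd point set \<Rightarrow> 'd point set \<Rightarrow> bool" where
  "perturbation \<delta> D D' \<longleftrightarrow>
     (\<exists>f. bij_betw f D D' \<and> (\<forall>p\<in>D. point_perturbation \<delta> p (f p)))"

definition numerically_dependent ::
  "'d::finite point set \<Rightarrow> ('d \<Rightarrow> real) \<Rightarrow> 'd power_product set \<Rightarrow> 'd power_product \<Rightarrow> bool" where
  "numerically_dependent D \<delta> Q t \<longleftrightarrow>
     (\<exists>D'. perturbation \<delta> D D' \<and>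
        design_vector t D' \<in>
          LinearCombinations.module.span class_ring (module_vec TYPE(real) (card D'))
            {design_vector s D' | s. s \<in> Q})"

definition full_column_rank :: "real mat \<Rightarrow> bool" where
  "full_column_rank A \<longleftrightarrow> vec_space.rank (dim_row A) A = dim_col A"

definition stable_order_ideal ::
  "'d::finite point set \<Rightarrow> ('d \<Rightarrow> real) \<Rightarrow> 'd power_product set \<Rightarrow> bool" where
  "stable_order_ideal D \<delta> Q \<longleftrightarrow>
     order_ideal Q \<and> (\<forall>D'. perturbation \<delta> D D' \<longrightarrow> full_column_rank (design_matrix Q D'))"

definition maximal_stable_order_ideal ::
  "'d::finite point set \<Rightarrow> ('d \<Rightarrow> real) \<Rightarrow> 'd power_product set \<Rightarrow> bool" where
  "maximal_stable_order_ideal D \<delta> Q \<longleftrightarrow>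
     stable_order_ideal D \<delta> Q \<and> \<not> (\<exists>Q'. stable_order_ideal D \<delta> Q' \<and> Q \<subset> Q')"

definition numerical_fan ::
  "'d::finite point set \<Rightarrow> ('d \<Rightarrow> real) \<Rightarrow> 'd power_product set set" where
  "numerical_fan D \<delta> = {Q. maximal_stable_order_ideal D \<delta> Q}"

text \<open>
  The procedures are written in the option monad by \<open>partial_function\<close>, so a call that does not
  terminate has the value \<open>None\<close>; no step of the programs returns \<open>None\<close> by itself.
\<close>

primrec for_each :: "'a list \<Rightarrow> ('a \<Rightarrow> 's \<Rightarrow> 's option) \<Rightarrow> 's \<Rightarrow> 's option" where
  "for_each [] body s = Some s"
| "for_each (x # xs) body s = do { s' \<leftarrow> body x s; for_each xs body s' }"

lemma for_each_mono [partial_function_mono]: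
  assumes "\<And>x s. mono_option (\<lambda>f. F f x s)"
  shows "mono_option (\<lambda>f. for_each xs (F f) s)"
proof (induction xs arbitrary: s)
  case Nil
  then show ?case by (simp add: option.const_mono)
next
  case (Cons x xs)
  have "mono_option (\<lambda>f. F f x s \<bind> (\<lambda>s'. for_each xs (F f) s'))"
    by (intro bind_mono assms Cons.IH)
  then show ?case by simp
qed

text \<open>The state is \<open>(S, \<O>, C, M, HS)\<close>.\<close>

type_synonym 'd state =
  "'d power_product set set \<times> 'd power_product set \<times> 'd power_product set \<times> real mat \<times>
   'd power_product set set"

text \<open>
  The order in which a call runs through its corner set is left open in the procedure. It is given
  here by a parameter which may depend on the whole input state of the call. As \<open>HS\<close> is enlarged
  before each recursive call, no two calls in a run have the same input state, so that every
  possible sequence of choices arises from such a parameter.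
\<close>

definition traversal_order :: "('d state \<Rightarrow> 'd power_product list) \<Rightarrow> bool" where
  "traversal_order ord \<longleftrightarrow>
     (\<forall>S Q C M HS. finite C \<longrightarrow>
        distinct (ord (S, Q, C, M, HS)) \<and> set (ord (S, Q, C, M, HS)) = C)"

partial_function (option) all_stable_oi_step ::
  "('d::finite state \<Rightarrow> 'd power_product list) \<Rightarrow> 'd point set \<Rightarrow> ('d \<Rightarrow> real) \<Rightarrow>
   'd state \<Rightarrow> 'd state option" where
  "all_stable_oi_step ord D \<delta> st =
    (case st of (S, Q_in, C_in, M_in, HS) \<Rightarrow>
      if Q_in \<in> S then Some st
      else do {
        (maxbool, S, Q, C, M, HS) \<leftarrow>
          for_each (ord st)
            (\<lambda>t (maxbool, S, _, _, _, HS).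
               if numerically_dependent D \<delta> Q_in t
               then Some (maxbool, S, Q_in, C_in, M_in, HS)
               else if insert t Q_in \<in> HS
               then Some (False, S, Q_in, C_in, M_in, HS)
               else do {
                 st' \<leftarrow> all_stable_oi_step ord D \<delta>
                   (S, insert t Q_in, corner_set (insert t Q_in),
                    mat_of_cols (card D) (cols M_in @ [design_vector t D]),
                    insert (insert t Q_in) HS);
                 Some (False, st')
               })
            (True, st);
        Some (if maxbool then insert Q S else S, Q, C, M, HS)
      })"

definition all_stable_order_ideals ::
  "('d::finite state \<Rightarrow> 'd power_product list) \<Rightarrow> 'd point set \<Rightarrow> ('d \<Rightarrow> real) \<Rightarrow>
   'd power_product set set option" where
  "all_stable_order_ideals ord D \<delta> = do {
     (S, Q, C, M, HS) \<leftarrow> all_stable_oi_step ord D \<delta> ({}, {}, {pp_one}, 0\<^sub>m (card D) 0, {});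
     Some S
   }"

end

theory Submission
  imports Defs
begin

text \<open>
  Over a stable order ideal \<open>\<O>\<close>, a corner \<open>t\<close> is numerically independent of \<open>\<O>\<close> exactly when
  \<open>\<O> \<union> {t}\<close> is again stable. Hence the procedure is a depth-first search through the graph whose
  vertices are the stable order ideals and whose edges add one corner, with \<open>HS\<close> as the set of
  visited vertices. Removing a term that is maximal for divisibility from a stable order ideal
  leaves a stable one, so every vertex can be reached from the empty set; and between two nested
  stable order ideals there is always an edge, so the vertices without outgoing edges are the
  maximal ones. The search is finite because a stable order ideal has at most \<open>n\<close> elements.
\<close>

section \<open>Full column rank\<close>

context vec_space
begin

text \<open>Independence of a set does not see repeated columns, hence the distinctness. It follows
  by counting: a maximal independent subset of the column set has \<open>rank A\<close> elements,
  and if these are \<open>nc\<close> many, no two of the \<open>nc\<close> columns coincide.\<close>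

lemma rank_eq_nc_iff:
  assumes A: "A \<in> carrier_mat n nc"
  shows "rank A = nc \<longleftrightarrow> distinct (cols A) \<and> lin_indpt (set (cols A))"
proof
  assume rank: "rank A = nc"
  have "lin_indpt {}"
    by (simp add: lin_dep_def)
  then obtain U where U: "maximal U (\<lambda>T. T \<subseteq> set (cols A) \<and> lin_indpt T)"
    using maximal_exists_superset[of "set (cols A)" "\<lambda>T. T \<subseteq> set (cols A) \<and> lin_indpt T" "{}"]
    by auto
  then have "U \<subseteq> set (cols A)"
    by (simp add: maximal_def)
  then have "nc \<le> card (set (cols A))"
    using rank rank_card_indpt[OF A U] by (metis List.finite_set card_mono)
  then have "distinct (cols A)"
    using A by (metis card_distinct card_length carrier_matD(2) cols_length le_antisym)
  then show "distinct (cols A) \<and> lin_indpt (set (cols A))"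
    using full_rank_lin_indpt[OF A rank] by blast
next
  assume "distinct (cols A) \<and> lin_indpt (set (cols A))"
  then show "rank A = nc"
    using lin_indpt_full_rank[OF A] by blast
qed

end

lemma enumeration_props:
  assumes "finite A"
  shows "distinct (enumeration A)" and "set (enumeration A) = A"
proof -
  have "\<exists>xs. distinct xs \<and> set xs = A"
    using finite_distinct_list[OF assms] by blast
  then have "distinct (enumeration A) \<and> set (enumeration A) = A"
    unfolding enumeration_def by (rule someI_ex)
  then show "distinct (enumeration A)" "set (enumeration A) = A"
    by simp_all
qed

text \<open>Replaces the matrix and its arbitrary column order by the family of design vectors;
  injectivity excludes repeated columns.\<close>

lemma full_column_rank_design_matrix_iff:
  assumes "finite Q"
  shows "full_column_rank (design_matrix Q E) \<longleftrightarrow>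
    inj_on (\<lambda>t. design_vector t E) Q \<and>
    \<not> LinearCombinations.module.lin_dep class_ring (module_vec TYPE(real) (card E))
        ((\<lambda>t. design_vector t E) ` Q)"
proof -
  interpret vec_space "TYPE(real)" "card E" .
  let ?vs = "map (\<lambda>t. design_vector t E) (enumeration Q)"
  have "set ?vs \<subseteq> carrier_vec (card E)"
    by (auto simp: design_vector_def)
  then have "cols (design_matrix Q E) = ?vs"
    by (simp add: design_matrix_def cols_mat_of_cols)
  moreover have "design_matrix Q E \<in> carrier_mat (card E) (dim_col (design_matrix Q E))"
    unfolding design_matrix_def by (rule carrier_matI) simp_all
  then have "rank (design_matrix Q E) = dim_col (design_matrix Q E) \<longleftrightarrow>
      distinct (cols (design_matrix Q E)) \<and> lin_indpt (set (cols (design_matrix Q E)))"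
    by (rule rank_eq_nc_iff)
  moreover have "dim_row (design_matrix Q E) = card E"
    by (simp add: design_matrix_def)
  ultimately show ?thesis
    using enumeration_props[OF assms] by (simp add: full_column_rank_def distinct_map)
qed

lemma full_column_rank_design_matrix_subset:
  assumes "full_column_rank (design_matrix Q E)" "finite Q" "P \<subseteq> Q"
  shows "full_column_rank (design_matrix P E)"
proof -
  interpret vec_space "TYPE(real)" "card E" .
  have "finite P"
    using assms finite_subset by blast
  then show ?thesis
    using assms subset_li_is_li[of "(\<lambda>t. design_vector t E) ` Q" "(\<lambda>t. design_vector t E) ` P"]
    by (auto simp: full_column_rank_design_matrix_iff image_mono intro: inj_on_subset)
qed

text \<open>Independent vectors live here in a space of dimension \<open>card E\<close>. This bound
  is what makes the search finite.\<close>

lemma card_le_of_full_column_rank: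
  assumes "full_column_rank (design_matrix Q E)" "finite Q"
  shows "card Q \<le> card E"
proof -
  interpret vec_space "TYPE(real)" "card E" .
  have "(\<lambda>t. design_vector t E) ` Q \<subseteq> carrier_vec (card E)"
    by (auto simp: design_vector_def)
  then have "card ((\<lambda>t. design_vector t E) ` Q) \<le> card E"
    using assms li_le_dim(2)[of "(\<lambda>t. design_vector t E) ` Q"]
    by (auto simp: full_column_rank_design_matrix_iff fin_dim dim_is_n)
  then show ?thesis
    using assms by (simp add: full_column_rank_design_matrix_iff card_image)
qed

lemma full_column_rank_design_matrix_insert:
  assumes "full_column_rank (design_matrix Q E)" "finite Q" "t \<notin> Q"
  shows "full_column_rank (design_matrix (insert t Q) E) \<longleftrightarrow>
    design_vector t E \<notin>
      LinearCombinations.module.span class_ring (module_vec TYPE(real) (card E))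
        {design_vector s E | s. s \<in> Q}"
proof -
  interpret vec_space "TYPE(real)" "card E" .
  let ?f = "\<lambda>t. design_vector t E"
  have eq: "{design_vector s E | s. s \<in> Q} = ?f ` Q"
    by auto
  have car: "?f ` Q \<subseteq> carrier_vec (card E)" "?f t \<in> carrier_vec (card E)"
    by (auto simp: design_vector_def)
  have inj: "inj_on ?f Q" and li: "lin_indpt (?f ` Q)"
    using assms by (simp_all add: full_column_rank_design_matrix_iff)
  show ?thesis
  proof (cases "?f t \<in> ?f ` Q")
    \<comment> \<open>The image set does not grow and stays independent; full rank is lost through
      injectivity.\<close>
    case True
    then have "?f t \<in> span (?f ` Q)"
      using span_mem car by blast
    then show ?thesis
      using True assms by (auto simp: full_column_rank_design_matrix_iff eq)
  next
    case False
    then show ?thesis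
      using lin_dep_iff_in_span[of "?f ` Q" "?f t"] car inj li assms
      by (auto simp: full_column_rank_design_matrix_iff eq)
  qed
qed

section \<open>Order ideals and corners\<close>

text \<open>Gives access to minimal and maximal elements of finite sets in the pointwise order. The
  truncated subtraction in the quotient is exact when \<open>s \<le> t\<close>.\<close>

lemma pp_dvd_iff_le: "pp_dvd s t \<longleftrightarrow> s \<le> t"
proof
  assume "s \<le> t"
  then have "t = pp_mult s (\<lambda>i. t i - s i)"
    by (simp add: pp_mult_def le_fun_def fun_eq_iff)
  then show "pp_dvd s t"
    unfolding pp_dvd_def by blast
qed (auto simp: pp_dvd_def pp_mult_def le_fun_def)

lemma order_ideal_empty: "order_ideal {}"
  by (simp add: order_ideal_def)

lemma order_ideal_insert:
  assumes "order_ideal Q" "t \<in> corner_set Q"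
  shows "order_ideal (insert t Q)"
  using assms unfolding order_ideal_def corner_set_def by auto

text \<open>Brings the initial corner set of the procedure into the form \<open>corner_set Q\<close>
  in which calls are specified.\<close>

lemma corner_set_empty: "corner_set {} = {pp_one}"
proof -
  have "pp_one \<le> s" for s :: "'a power_product"
    by (simp add: pp_one_def le_fun_def)
  moreover have "s = pp_one" if "s \<le> pp_one" for s :: "'a power_product"
    using that by (auto simp: pp_one_def le_fun_def)
  ultimately show ?thesis
    by (auto simp: corner_set_def pp_dvd_iff_le)
qed

text \<open>A corner other than \<open>1\<close> is an indeterminate times an element of the order ideal.\<close>

lemma finite_corner_set:
  fixes Q :: "('d::finite) power_product set"
  assumes "order_ideal Q"
  shows "finite (corner_set Q)"
proof (rule finite_subset)
  show "corner_set Q \<subseteq> insert pp_one ((\<lambda>(i, s). s(i := Suc (s i))) ` (UNIV \<times> Q))"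
  proof
    fix t assume t: "t \<in> corner_set Q"
    show "t \<in> insert pp_one ((\<lambda>(i, s). s(i := Suc (s i))) ` (UNIV \<times> Q))"
    proof (cases "t = pp_one")
      case False
      then obtain i where i: "t i > 0"
        by (auto simp: pp_one_def fun_eq_iff)
      let ?s = "t(i := t i - 1)"
      have "?s \<le> t"
        by (simp add: le_fun_def)
      moreover have "?s \<noteq> t"
        using i by (auto simp: fun_eq_iff)
      ultimately have "?s \<in> Q"
        using t by (auto simp: corner_set_def pp_dvd_iff_le)
      moreover have "t = (\<lambda>(i, s). s(i := Suc (s i))) (i, ?s)"
        using i by (auto simp: fun_eq_iff)
      ultimately show ?thesis
        by blast
    qed simp
  qed
  show "finite (insert pp_one ((\<lambda>(i, s). s(i := Suc (s i))) ` ((UNIV :: 'd set) \<times> Q)))"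
    using assms by (simp add: order_ideal_def)
qed

text \<open>A minimal element of \<open>P - Q\<close> works: its proper divisors lie in
  \<open>P\<close> by closure, hence in \<open>Q\<close> by minimality.\<close>

lemma ex_corner_in_larger_order_ideal:
  assumes "order_ideal P" "Q \<subset> P"
  shows "\<exists>t\<in>corner_set Q. t \<in> P"
proof -
  have "finite (P - Q)" "P - Q \<noteq> {}"
    using assms by (auto simp: order_ideal_def)
  then have "\<exists>t\<in>P - Q. \<forall>s\<in>P - Q. s \<le> t \<longrightarrow> t = s"
    by (rule finite_has_minimal)
  then obtain t where t: "t \<in> P - Q" and min: "\<forall>s\<in>P - Q. s \<le> t \<longrightarrow> t = s" ..
  have "s = t" if "s \<notin> Q" "s \<le> t" for s
  proof -
    have "s \<in> P"
      using assms(1) t that(2) by (auto simp: order_ideal_def pp_dvd_iff_le)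
    then show ?thesis
      using min that by blast
  qed
  then have "t \<in> corner_set Q"
    using t by (simp add: corner_set_def pp_dvd_iff_le)
  then show ?thesis
    using t by blast
qed

text \<open>A maximal \<open>t\<close> divides no other element, so its removal keeps closure, and
  all its proper divisors remain, so it becomes a corner.\<close>

lemma order_ideal_remove_maximal:
  assumes "order_ideal P" "P \<noteq> {}"
  obtains t where "t \<in> P" "order_ideal (P - {t})" "t \<in> corner_set (P - {t})"
proof -
  have "finite P"
    using assms by (simp add: order_ideal_def)
  then have "\<exists>t\<in>P. \<forall>s\<in>P. t \<le> s \<longrightarrow> t = s"
    using assms(2) by (rule finite_has_maximal)
  then obtain t where t: "t \<in> P" and max: "\<forall>s\<in>P. t \<le> s \<longrightarrow> t = s" ..
  have down: "s \<in> P" if "r \<in> P" "s \<le> r" for r s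
    using assms(1) that by (simp add: order_ideal_def pp_dvd_iff_le)
  have "\<forall>r\<in>P - {t}. \<forall>s\<le>r. s \<in> P - {t}"
  proof (intro ballI allI impI)
    fix r s assume "r \<in> P - {t}" "s \<le> r"
    then show "s \<in> P - {t}"
      using down[of r s] max by auto
  qed
  then have "order_ideal (P - {t})"
    using \<open>finite P\<close> unfolding order_ideal_def pp_dvd_iff_le by (intro conjI finite_Diff)
  moreover have "t \<in> corner_set (P - {t})"
    using down[OF t] unfolding corner_set_def pp_dvd_iff_le by blast
  ultimately show ?thesis
    using that t by blast
qed

section \<open>Stable order ideals\<close>

lemma stable_order_ideal_subset:
  assumes "stable_order_ideal D \<delta> Q" "order_ideal P" "P \<subseteq> Q"
  shows "stable_order_ideal D \<delta> P"
proof -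
  have "finite Q"
    using assms(1) by (simp add: stable_order_ideal_def order_ideal_def)
  then show ?thesis
    using assms full_column_rank_design_matrix_subset unfolding stable_order_ideal_def by blast
qed

lemma stable_order_ideal_empty: "stable_order_ideal D \<delta> {}"
proof -
  have "full_column_rank (design_matrix {} E)" for E :: "'a point set"
  proof -
    interpret vec_space "TYPE(real)" "card E" .
    show ?thesis
      by (simp add: full_column_rank_design_matrix_iff lin_dep_def)
  qed
  then show ?thesis
    by (simp add: stable_order_ideal_def order_ideal_empty)
qed

lemma perturbation_refl:
  assumes "\<forall>i. \<delta> i \<ge> 0"
  shows "perturbation \<delta> D D"
  unfolding perturbation_def point_perturbation_def
  using assms by (intro exI[of _ id]) auto

text \<open>Tolerances are nonnegative, so \<open>D\<close> is a perturbation of itself and the rank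
  bound applies to it.\<close>

lemma card_stable_order_ideal_le:
  assumes "\<forall>i. \<delta> i \<ge> 0" "stable_order_ideal D \<delta> Q"
  shows "card Q \<le> card D"
proof (rule card_le_of_full_column_rank)
  show "full_column_rank (design_matrix Q D)"
    using assms perturbation_refl by (auto simp: stable_order_ideal_def)
  show "finite Q"
    using assms(2) by (simp add: stable_order_ideal_def order_ideal_def)
qed

text \<open>For each perturbation separately, the new column preserves full rank iff it lies outside
  the span of the old ones; a perturbation violating this is exactly a witness of numerical
  dependence.\<close>

lemma stable_order_ideal_insert_iff:
  assumes "stable_order_ideal D \<delta> Q" "t \<in> corner_set Q"
  shows "stable_order_ideal D \<delta> (insert t Q) \<longleftrightarrow> \<not> numerically_dependent D \<delta> Q t"
proof -
  have "order_ideal Q" "finite Q" "t \<notin> Q"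
    using assms by (auto simp: stable_order_ideal_def order_ideal_def corner_set_def)
  then show ?thesis
    using assms order_ideal_insert[of Q t] full_column_rank_design_matrix_insert[of Q _ t]
    unfolding stable_order_ideal_def numerically_dependent_def by blast
qed

text \<open>Local maximality suffices: a stable \<open>P\<close> above \<open>Q\<close> contains a
  corner \<open>t\<close> of \<open>Q\<close>, and \<open>insert t Q\<close>, an order ideal inside
  \<open>P\<close>, inherits stability.\<close>

lemma numerical_fan_iff_no_stable_insert:
  assumes "stable_order_ideal D \<delta> Q"
  shows "Q \<in> numerical_fan D \<delta> \<longleftrightarrow>
    (\<forall>t\<in>corner_set Q. \<not> stable_order_ideal D \<delta> (insert t Q))"
proof
  assume *: "\<forall>t\<in>corner_set Q. \<not> stable_order_ideal D \<delta> (insert t Q)"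
  have False if P: "stable_order_ideal D \<delta> P" "Q \<subset> P" for P
  proof -
    obtain t where t: "t \<in> corner_set Q" "t \<in> P"
      using ex_corner_in_larger_order_ideal P by (metis stable_order_ideal_def)
    then have "stable_order_ideal D \<delta> (insert t Q)"
      using P assms order_ideal_insert stable_order_ideal_subset
      by (metis insert_subset psubset_imp_subset stable_order_ideal_def)
    then show False
      using * t by blast
  qed
  then show "Q \<in> numerical_fan D \<delta>"
    using assms by (auto simp: numerical_fan_def maximal_stable_order_ideal_def)
next
  assume Q: "Q \<in> numerical_fan D \<delta>"
  show "\<forall>t\<in>corner_set Q. \<not> stable_order_ideal D \<delta> (insert t Q)"
  proof
    fix t assume "t \<in> corner_set Q"
    then have "Q \<subset> insert t Q"
      by (auto simp: corner_set_def)
    then show "\<not> stable_order_ideal D \<delta> (insert t Q)"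
      using Q by (auto simp: numerical_fan_def maximal_stable_order_ideal_def)
  qed
qed

section \<open>The depth-first search\<close>

text \<open>The invariant is indexed by the set of processed elements, so it does not depend on
  their order. The conclusion includes termination of the loop.\<close>

lemma for_each_invariant:
  assumes "I {} s"
    and "\<And>x A s. x \<in> set xs \<Longrightarrow> I A s \<Longrightarrow> \<exists>s'. body x s = Some s' \<and> I (insert x A) s'"
  shows "\<exists>s'. for_each xs body s = Some s' \<and> I (set xs) s'"
proof -
  \<comment> \<open>The induction runs over remaining lists \<open>ys\<close>, so the set
    \<open>A\<close> already processed must be arbitrary.\<close>
  have "\<exists>s'. for_each ys body s = Some s' \<and> I (A \<union> set ys) s'"
    if "I A s" "set ys \<subseteq> set xs" for A s ys
    using that
  proof (induction ys arbitrary: A s)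
    case (Cons y ys)
    then obtain s1 where s1: "body y s = Some s1" "I (insert y A) s1"
      using assms(2) by (metis insert_subset list.simps(15))
    then show ?case
      using Cons.IH[of "insert y A" s1] Cons.prems by simp
  qed simp
  from this[of "{}" s xs] show ?thesis
    using assms(1) by simp
qed

text \<open>The state of a vertex whose call has finished: its edges are explored, and a sink is
  recorded. Only membership in the growing sets \<open>S\<close> and \<open>HS\<close> is asked for,
  so the property persists.\<close>

definition completed ::
  "('d::finite) point set \<Rightarrow> ('d \<Rightarrow> real) \<Rightarrow> 'd power_product set set \<Rightarrow>
   'd power_product set set \<Rightarrow> 'd power_product set \<Rightarrow> bool" where
  "completed D \<delta> S HS P \<longleftrightarrow>
     (\<forall>t\<in>corner_set P. stable_order_ideal D \<delta> (insert t P) \<longrightarrow> insert t P \<in> HS) \<and>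
     (P \<in> numerical_fan D \<delta> \<longrightarrow> P \<in> S)"

lemma completed_mono:
  assumes "completed D \<delta> S HS P" "S \<subseteq> S'" "HS \<subseteq> HS'"
  shows "completed D \<delta> S' HS' P"
  using assms by (auto simp: completed_def)

text \<open>Vertices in \<open>HS\<close> on entry may belong to calls still open, so completion is
  claimed only for \<open>Q\<close> and the vertices added during the call. The value
  \<open>Some\<close> expresses termination.\<close>

lemma all_stable_oi_step_spec:
  fixes D :: "('d::finite) point set"
  assumes \<delta>: "\<forall>i. \<delta> i \<ge> 0"
    and ord: "traversal_order ord"
    and "stable_order_ideal D \<delta> Q" "S \<subseteq> numerical_fan D \<delta>"
  shows "\<exists>S' Q' C' M' HS'.
    all_stable_oi_step ord D \<delta> (S, Q, corner_set Q, M, HS) = Some (S', Q', C', M', HS') \<and>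
    S \<subseteq> S' \<and> S' \<subseteq> numerical_fan D \<delta> \<and> HS \<subseteq> HS' \<and>
    (\<forall>P \<in> insert Q (HS' - HS). completed D \<delta> S' HS' P)"
  using assms(3-)
proof (induction "card D - card Q" arbitrary: S Q M HS rule: less_induct)
  case less
  note stable = less.prems(1) and S = less.prems(2)
  show ?case
  proof (cases "Q \<in> S")
    \<comment> \<open>Only maximal ideals are in \<open>S\<close>, so \<open>Q\<close> has no edge
      left to explore.\<close>
    case True
    then have "Q \<in> numerical_fan D \<delta>"
      using S by blast
    then have "completed D \<delta> S HS Q"
      using True numerical_fan_iff_no_stable_insert[OF stable] by (auto simp: completed_def)
    then show ?thesis
      using True S by (subst all_stable_oi_step.simps) auto
  next
    case False
    let ?C = "corner_set Q"
    let ?st = "(S, Q, ?C, M, HS)"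
    let ?body = "\<lambda>t (maxbool, S, _, _, _, HS).
       if numerically_dependent D \<delta> Q t
       then Some (maxbool, S, Q, ?C, M, HS)
       else if insert t Q \<in> HS
       then Some (False, S, Q, ?C, M, HS)
       else do {
         st' \<leftarrow> all_stable_oi_step ord D \<delta>
           (S, insert t Q, corner_set (insert t Q),
            mat_of_cols (card D) (cols M @ [design_vector t D]),
            insert (insert t Q) HS);
         Some (False, st')
       }"
    \<comment> \<open>\<open>A\<close> is the set of processed corners. A recursive call may return
      another current ideal, but then the flag is false; hence \<open>Q' = Q\<close> is claimed only
      under \<open>maxbool\<close>.\<close>
    let ?I = "\<lambda>A (maxbool, S', Q', C' :: 'd power_product set, M' :: real mat, HS').
       S \<subseteq> S' \<and> S' \<subseteq> numerical_fan D \<delta> \<and> HS \<subseteq> HS' \<and>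
       (\<forall>P \<in> HS' - HS. completed D \<delta> S' HS' P) \<and>
       (\<forall>t\<in>A. stable_order_ideal D \<delta> (insert t Q) \<longrightarrow> insert t Q \<in> HS') \<and>
       (maxbool \<longrightarrow> Q' = Q) \<and>
       (maxbool \<longleftrightarrow> (\<forall>t\<in>A. \<not> stable_order_ideal D \<delta> (insert t Q)))"
    have order_ideal: "order_ideal Q"
      using stable by (simp add: stable_order_ideal_def)
    \<comment> \<open>A traversal order promises a full listing only for finite corner sets.\<close>
    then have ord_set: "set (ord ?st) = ?C"
      using ord finite_corner_set[of Q] by (simp add: traversal_order_def)
    have "\<exists>s'. for_each (ord ?st) ?body (True, ?st) = Some s' \<and> ?I (set (ord ?st)) s'"
    proof (rule for_each_invariant)
      show "?I {} (True, ?st)"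
        using S by simp
    next
      fix t A s
      assume "t \<in> set (ord ?st)" and inv: "?I A s"
      then have t: "t \<in> ?C"
        using ord_set by simp
      obtain mb S1 Q1 C1 M1 HS1 where s: "s = (mb, S1, Q1, C1, M1, HS1)"
        by (rule prod_cases6)
      note iff = stable_order_ideal_insert_iff[OF stable t]
      show "\<exists>s'. ?body t s = Some s' \<and> ?I (insert t A) s'"
      proof (cases "numerically_dependent D \<delta> Q t \<or> insert t Q \<in> HS1")
        case True
        then show ?thesis
          using inv iff unfolding s by (cases "numerically_dependent D \<delta> Q t") auto
      next
        case False
        then have stable': "stable_order_ideal D \<delta> (insert t Q)"
          using iff by blast
        have "card (insert t Q) = Suc (card Q)"
          using t order_ideal by (simp add: corner_set_def order_ideal_def)
        \<comment> \<open>The bound on the larger ideal gives \<open>card Q < card D\<close>, so the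
          truncated difference really decreases.\<close>
        then have "card D - card (insert t Q) < card D - card Q"
          using card_stable_order_ideal_le[OF \<delta> stable'] by linarith
        moreover have "S1 \<subseteq> numerical_fan D \<delta>"
          using inv unfolding s by simp
        ultimately obtain S2 Q2 C2 M2 HS2 where step:
          "all_stable_oi_step ord D \<delta> (S1, insert t Q, corner_set (insert t Q),
             mat_of_cols (card D) (cols M @ [design_vector t D]), insert (insert t Q) HS1) =
           Some (S2, Q2, C2, M2, HS2)"
          and sub: "S1 \<subseteq> S2" "S2 \<subseteq> numerical_fan D \<delta>" "insert (insert t Q) HS1 \<subseteq> HS2"
          and compl: "\<forall>P \<in> insert (insert t Q) (HS2 - insert (insert t Q) HS1).
             completed D \<delta> S2 HS2 P"
          using less.hyps[OF _ stable'] by metis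
        have "?body t s = Some (False, S2, Q2, C2, M2, HS2)"
          using False step unfolding s by simp
        \<comment> \<open>Vertices visited earlier in the loop stay completed by monotonicity. The
          others are \<open>insert t Q\<close>, entered just before the recursive call, or were
          added during it.\<close>
        moreover have "completed D \<delta> S2 HS2 P" if "P \<in> HS2 - HS" for P
        proof (cases "P \<in> HS1")
          case True
          then show ?thesis
            using that inv sub completed_mono[of D \<delta> S1 HS1 P S2 HS2] unfolding s by auto
        next
          case False
          then show ?thesis
            using that compl by auto
        qed
        then have "?I (insert t A) (False, S2, Q2, C2, M2, HS2)"
          using inv sub stable' unfolding s by auto
        ultimately show ?thesis
          by blast
      qed
    qed
    then obtain s' where s': "for_each (ord ?st) ?body (True, ?st) = Some s'" "?I ?C s'"
      unfolding ord_set by blast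
    obtain mb S' Q' C' M' HS' where s'_eq: "s' = (mb, S', Q', C', M', HS')"
      by (rule prod_cases6)
    have loop: "for_each (ord ?st) ?body (True, ?st) = Some (mb, S', Q', C', M', HS')"
      and inv: "?I ?C (mb, S', Q', C', M', HS')"
      using s' unfolding s'_eq by blast+
    let ?S = "if mb then insert Q' S' else S'"
    \<comment> \<open>With all corners processed, the flag expresses local maximality of
      \<open>Q\<close>.\<close>
    have mb: "mb \<longleftrightarrow> Q \<in> numerical_fan D \<delta>"
      using inv numerical_fan_iff_no_stable_insert[OF stable] by simp
    have "all_stable_oi_step ord D \<delta> ?st = Some (?S, Q', C', M', HS')"
      using False loop by (subst all_stable_oi_step.simps) simp
    moreover have "S \<subseteq> ?S" "?S \<subseteq> numerical_fan D \<delta>" "HS \<subseteq> HS'"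
      using inv mb by auto
    moreover have "completed D \<delta> ?S HS' P" if "P \<in> insert Q (HS' - HS)" for P
    proof (cases "P = Q")
      case True
      then show ?thesis
        using inv mb by (auto simp: completed_def)
    next
      case False
      then have "completed D \<delta> S' HS' P"
        using that inv by simp
      then show ?thesis
        by (rule completed_mono) auto
    qed
    ultimately show ?thesis
      by blast
  qed
qed

text \<open>Removing a maximal term gives a smaller stable ideal, visited by induction and thus
  completed, so the edge back to \<open>P\<close> has been followed. The empty set is adjoined
  because the search starts there without entering it in \<open>HS\<close>.\<close>

lemma stable_order_ideal_visited:
  assumes "\<And>P. P \<in> insert {} HS \<Longrightarrow> completed D \<delta> S HS P"
    and "stable_order_ideal D \<delta> P"
  shows "P \<in> insert {} HS"
  using assms(2)
proof (induction "card P" arbitrary: P rule: less_induct)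
  case less
  then have P: "order_ideal P" "finite P"
    by (simp_all add: stable_order_ideal_def order_ideal_def)
  show ?case
  proof (cases "P = {}")
    case False
    then obtain t where t: "t \<in> P" "order_ideal (P - {t})" "t \<in> corner_set (P - {t})"
      using order_ideal_remove_maximal P by blast
    have "stable_order_ideal D \<delta> (P - {t})"
      using stable_order_ideal_subset[OF less.prems t(2)] by blast
    then have "P - {t} \<in> insert {} HS"
      using less.hyps t(1) P(2) by (metis card_Diff1_less)
    then have "completed D \<delta> S HS (P - {t})"
      by (rule assms(1))
    moreover have "insert t (P - {t}) = P"
      using t(1) by blast
    ultimately show ?thesis
      using t(3) less.prems unfolding completed_def by (metis insertCI)
  qed simp
qed

theorem theorem3:
  fixes K :: "real set"
    and D :: "('d::finite) point set"
    and \<delta> :: "'d \<Rightarrow> real"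
    and ord :: "'d state \<Rightarrow> 'd power_product list"
  assumes "K = \<rat> \<or> K = \<real>"
    and "empirical_design K D \<delta>"
    and "traversal_order ord"
  shows "all_stable_order_ideals ord D \<delta> = Some (numerical_fan D \<delta>)"
proof -
  have \<delta>: "\<forall>i. \<delta> i \<ge> 0"
    using assms(2) by (simp add: empirical_design_def)
  obtain S Q C M HS where
    step: "all_stable_oi_step ord D \<delta> ({}, {}, {pp_one}, 0\<^sub>m (card D) 0, {}) =
      Some (S, Q, C, M, HS)"
    and S: "S \<subseteq> numerical_fan D \<delta>"
    and compl: "\<forall>P \<in> insert {} HS. completed D \<delta> S HS P"
    using all_stable_oi_step_spec[OF \<delta> assms(3) stable_order_ideal_empty, where S = "{}" and
        HS = "{}" and M = "0\<^sub>m (card D) 0" and D = D]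
    by (auto simp: corner_set_empty)
  \<comment> \<open>The run starts with empty \<open>HS\<close>, so every visited vertex is
    completed; a maximal ideal is visited and therefore recorded.\<close>
  have "numerical_fan D \<delta> \<subseteq> S"
  proof
    fix P assume P: "P \<in> numerical_fan D \<delta>"
    then have "P \<in> insert {} HS"
      using stable_order_ideal_visited[of HS D \<delta> S P] compl
      by (auto simp: numerical_fan_def maximal_stable_order_ideal_def)
    then show "P \<in> S"
      using compl P by (auto simp: completed_def)
  qed
  with S have "S = numerical_fan D \<delta>"
    by blast
  then show ?thesis
    by (simp add: all_stable_order_ideals_def step)
qed

end
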